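(* Let $d\ge1$ and $\Omega=\mathbb{R}^{d-1}\times\mathbb{R}_+=\{(\tilde x,x[d]):\tilde x\in\mathbb{R}^{d-1},\ x[d]\ge0\}$. Suppose that each $f_i$ is $L$-smooth on $\Omega$ ($L>0$), i.e. $\|\nabla f_i(x)-\nabla f_i(y)\|\le L\|x-y\|$ for all $x,y\in\Omega$; that $f$ is $\mu$-strongly convex on $\Omega$ ($\mu>0$), i.e. $f(y)\ge f(x)+\langle y-x,\nabla f(x)\rangle+\frac\mu2\|y-x\|^2$ for all $x,y\in\Omega$; and that $\mathcal G$ and $W$ are as in the context. Suppose the minimizer of $f$ over $\Omega$ lies on the boundary, $x_*=(\tilde x_*,0)$ with $\tilde x_*\in\mathbb{R}^{d-1}$, and satisfies $\partial_df(x_* )=\frac1n\sum_{i=1}^n\partial_df_i(x_* )\ge\omega>0$. Suppose also that there is a constant $R_s>0$ (not depending on $\alpha$) such that $\|\mathbf{x}(t)-\mathbf{x}_*\|^2\le R_s$ for all $t\ge0$. If the stepsize is a constant $\alpha(t)\equiv\alpha>0$ with $\alpha\le\frac{2}{L+\mu}$, then $$\limsup_{t\to\infty}\|x_k(t)-x_*\|=O(\alpha)\qquad\text{for all }1\le k\le n,$$ i.e. the limsup is at most $C\alpha$ with a constant $C$ independent of $\alpha\in(0,\frac{2}{L+\mu}]$.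
   Context: Let $n\ge1$, $f_i:\Omega\to\mathbb{R}$ ($1\le i\le n$) be differentiable functions, and $f=\frac1n\sum_{i=1}^n f_i$. $\partial_d$ denotes the $d$-th component of the gradient and $x[d]$ the $d$-th component of $x\in\mathbb R^d$. $\|\cdot\|$ is the Euclidean norm and $\mathcal{P}_\Omega[y]=\arg\min_{x\in\Omega}\|x-y\|$. $x_*$ denotes the unique minimizer of $f$ over $\Omega$. Network: $\mathcal{G}=(\mathcal V,\mathcal E)$, $\mathcal V=\{1,\dots,n\}$, is a fixed (time-independent) connected undirected graph. The mixing matrix $W=[w_{ij}]$ has nonnegative entries, with $w_{ij}\ne0$ if $\{i,j\}\in\mathcal E$ and, for $i\neq j$, $w_{ij}=0$ if $\{i,j\}\notin\mathcal E$; $W$ is symmetric and doubly stochastic, $w_{ii}>0$ for all $i$, and $\mathrm{null}(I-W)=\mathrm{span}\{(1,\dots,1)^T\}$. Decentralized projected gradient (DPG) iterates: given $x_i(0)\in\Omega$ and stepsizes $\alpha(t)>0$, $$x_i(t+1)=\mathcal{P}_\Omega\Big[\sum_{j=1}^n w_{ij}x_j(t)-\alpha(t)\nabla f_i(x_i(t))\Big],\qquad 1\le i\le n,\ t\ge0.$$ $\mathbf{x}(t)=(x_1(t),\dots,x_n(t))$ and $\mathbf{x}_*=(x_*,\dots,x_* )$ in $\mathbb{R}^{dn}$. *)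

theory Defs
  imports "HOL-Analysis.Analysis"
begin

text \<open>
  Points of $\mathbb{R}^d$ are vectors of type \<open>real ^ 'd\<close>, so \<open>d = CARD('d) \<ge> 1\<close>; the
  \<open>d\<close>-th coordinate is represented by a distinguished index \<open>l :: 'd\<close>. The agents are the
  elements of a finite type \<open>'n\<close>, and \<open>\<^bold>x(t)\<close> has type \<open>(real ^ 'd) ^ 'n\<close>, whose norm is
  the Euclidean norm of $\mathbb{R}^{dn}$.
\<close>

definition half_space :: "'d::finite \<Rightarrow> (real ^ 'd) set" where
  "half_space l = {x. x $ l \<ge> 0}"

text \<open>
  The gradient is taken relative to \<open>S\<close>, since the functions are only given on \<open>S\<close>; at boundary
  points it is the one-sided one. On a half-space it is unique, see
  \<open>gradient_half_space_eqI\<close> below.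
\<close>

definition gradient :: "'a::real_inner set \<Rightarrow> ('a \<Rightarrow> real) \<Rightarrow> 'a \<Rightarrow> 'a" where
  "gradient S f x = (THE g. (f has_derivative (\<lambda>h. g \<bullet> h)) (at x within S))"

lemma gradient_half_space_eqI:
  fixes f :: "real ^ 'd::finite \<Rightarrow> real"
  assumes x: "x \<in> half_space l"
    and f: "(f has_derivative (\<lambda>h. g \<bullet> h)) (at x within half_space l)"
  shows "gradient (half_space l) f x = g"
  unfolding gradient_def
proof (rule the_equality[where P = "\<lambda>g. (f has_derivative (\<lambda>h. g \<bullet> h)) (at x within half_space l)"])
  show "(f has_derivative (\<lambda>h. g \<bullet> h)) (at x within half_space l)" by (fact f)
next
  fix g' assume g': "(f has_derivative (\<lambda>h. g' \<bullet> h)) (at x within half_space l)"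
  have "(\<lambda>h. g' \<bullet> h) = (\<lambda>h. g \<bullet> h)"
  proof (rule frechet_derivative_unique_within[OF g' f])
    fix i :: "real ^ 'd" and e :: real
    assume i: "i \<in> Basis" and e: "0 < e"
    have "i $ l \<ge> 0" using i by (auto simp: Basis_vec_def axis_def)
    with x e have "x + (e / 2) *\<^sub>R i \<in> half_space l" by (simp add: half_space_def)
    with e show "\<exists>d. 0 < \<bar>d\<bar> \<and> \<bar>d\<bar> < e \<and> x + d *\<^sub>R i \<in> half_space l"
      by (intro exI[of _ "e / 2"]) auto
  qed
  then have "(g' - g) \<bullet> (g' - g) = 0" by (metis inner_diff_left right_minus_eq)
  then show "g' = g" by simp
qed

definition smooth_on :: "real \<Rightarrow> 'a::real_inner set \<Rightarrow> ('a \<Rightarrow> real) \<Rightarrow> bool" where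
  "smooth_on L S f \<longleftrightarrow> (\<forall>x\<in>S. \<forall>y\<in>S. norm (gradient S f x - gradient S f y) \<le> L * norm (x - y))"

definition strongly_convex_on :: "real \<Rightarrow> 'a::real_inner set \<Rightarrow> ('a \<Rightarrow> real) \<Rightarrow> bool" where
  "strongly_convex_on \<mu> S f \<longleftrightarrow>
     (\<forall>x\<in>S. \<forall>y\<in>S. f y \<ge> f x + (y - x) \<bullet> gradient S f x + \<mu> / 2 * (norm (y - x))\<^sup>2)"

definition average :: "('n::finite \<Rightarrow> 'a \<Rightarrow> real) \<Rightarrow> 'a \<Rightarrow> real" where
  "average f = (\<lambda>x. 1 / real CARD('n) * (\<Sum>i\<in>UNIV. f i x))"

definition connected_graph :: "'n set set \<Rightarrow> bool" where
  "connected_graph E \<longleftrightarrow>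
     (\<forall>e\<in>E. card e = 2) \<and> (\<forall>i j. (i, j) \<in> {(a, b). {a, b} \<in> E}\<^sup>*)"

definition mixing_matrix :: "'n::finite set set \<Rightarrow> real ^ 'n ^ 'n \<Rightarrow> bool" where
  "mixing_matrix E W \<longleftrightarrow>
     (\<forall>i j. W $ i $ j \<ge> 0) \<and>
     (\<forall>i j. {i, j} \<in> E \<longrightarrow> W $ i $ j \<noteq> 0) \<and>
     (\<forall>i j. i \<noteq> j \<and> {i, j} \<notin> E \<longrightarrow> W $ i $ j = 0) \<and>
     transpose W = W \<and>
     (\<forall>i. (\<Sum>j\<in>UNIV. W $ i $ j) = 1) \<and> (\<forall>j. (\<Sum>i\<in>UNIV. W $ i $ j) = 1) \<and>
     (\<forall>i. W $ i $ i > 0) \<and>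
     {v. (mat 1 - W) *v v = 0} = span {\<chi> i. 1}"

definition dpg_iterates ::
  "'a::euclidean_space set \<Rightarrow> real ^ 'n ^ 'n \<Rightarrow> ('n::finite \<Rightarrow> 'a \<Rightarrow> real) \<Rightarrow>
   (nat \<Rightarrow> real) \<Rightarrow> (nat \<Rightarrow> 'a ^ 'n) \<Rightarrow> bool" where
  "dpg_iterates S W f \<alpha> x \<longleftrightarrow>
     (\<forall>i. x 0 $ i \<in> S) \<and>
     (\<forall>t i. x (Suc t) $ i =
        closest_point S ((\<Sum>j\<in>UNIV. W $ i $ j *\<^sub>R x t $ j) - \<alpha> t *\<^sub>R gradient S (f i) (x t $ i)))"

end

theory Submission
  imports Defs
begin

text \<open>
  The projections of the agents do not commute with averaging, and on a general convex set the
  energy estimate below, which gives order \<open>sqrt \<alpha>\<close>, is where the argument would end. On a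
  half-space the projection acts on a single coordinate, and a positive normal derivative at the
  optimum makes it possible to treat this coordinate and the others separately, which gives order
  \<open>\<alpha>\<close>. All bounds hold eventually in \<open>t\<close>, with constants that depend neither on \<open>\<alpha>\<close> nor on
  the run, provided that \<open>\<alpha>\<close> is small.

  \<^item> The gradients along the run are bounded, so one step is mixing up to an error of order \<open>\<alpha>\<close>.
    Mixing contracts the deviation from the mean by a factor below \<open>1\<close>
    (\<open>mix_contracts_deviation\<close>), hence all agents agree up to order \<open>\<alpha>\<close>
    (\<open>eventually_deviation_le\<close>).

  \<^item> The projection does not increase the distance to \<open>xs\<close>. As the agents agree up to order \<open>\<alpha>\<close>,
    strong convexity of the average shrinks the squared distance by the factor \<open>1 - \<alpha> * \<mu>\<close>, up to an
    error of order \<open>\<alpha>\<^sup>2\<close>. So the squared distance becomes of order \<open>\<alpha>\<close>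
    (\<open>eventually_norm_sq_le\<close>). This is the rate \<open>sqrt \<alpha>\<close>; for small \<open>\<alpha>\<close> it suffices to keep the
    mean normal derivative above \<open>\<omega> / 2\<close>.

  \<^item> While the mean normal coordinate exceeds a fixed multiple of \<open>\<alpha>\<close>, no agent is projected, and
    the positive normal derivative pushes that coordinate down by at least \<open>\<alpha> * \<omega> / 2\<close> per step.
    Hence it becomes of order \<open>\<alpha>\<close> (\<open>eventually_mean_normal_le\<close>).

  \<^item> The tangential coordinates are never projected. Their mean makes an inexact gradient step for
    the average function restricted to the boundary, with gradient error of order \<open>\<alpha>\<close>, since all
    agents are that close to the boundary. An exact step contracts by \<open>1 - \<alpha> * \<mu> / 4\<close>
    (\<open>boundary_step_contracts\<close>), so the tangential error is of order \<open>\<alpha>\<close> as well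
    (\<open>eventually_tangential_le\<close>).
\<close>

section \<open>Stacked vectors, means and deviations\<close>

lemma inner_vec_eq_sum: "inner x y = (\<Sum>i\<in>UNIV. inner (x $ i) (y $ i))"
  for x y :: "'a::real_inner ^ 'n::finite"
  by (simp add: inner_vec_def)

lemma norm_sq_vec_eq_sum: "(norm x)\<^sup>2 = (\<Sum>i\<in>UNIV. (norm (x $ i))\<^sup>2)"
  for x :: "'a::real_inner ^ 'n::finite"
  by (simp add: inner_vec_def power2_norm_eq_inner)

lemma norm_le_scaled_componentwise:
  fixes x :: "'a::real_normed_vector ^ 'n::finite" and y :: "'b::real_normed_vector ^ 'n"
  assumes "\<And>i. norm (x $ i) \<le> c * norm (y $ i)" and "0 \<le> c"
  shows "norm x \<le> c * norm y"
proof -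
  have "norm x \<le> L2_set (\<lambda>i. c * norm (y $ i)) UNIV"
    unfolding norm_vec_def by (rule L2_set_mono) (use assms in auto)
  also have "\<dots> = c * norm y"
    using assms(2) by (simp add: norm_vec_def L2_set_right_distrib)
  finally show ?thesis .
qed

lemma norm_sq_diff_scaleR:
  fixes u g :: "'a::real_inner"
  shows "(norm (u - c *\<^sub>R g))\<^sup>2 = (norm u)\<^sup>2 - 2 * c * inner u g + c\<^sup>2 * (norm g)\<^sup>2"
  unfolding power2_norm_eq_inner
  by (simp add: inner_diff inner_commute[of g u] power2_eq_square algebra_simps)

definition mean :: "'a::real_vector ^ 'n::finite \<Rightarrow> 'a" where
  "mean v = (1 / real CARD('n)) *\<^sub>R (\<Sum>i\<in>UNIV. v $ i)"

definition deviation :: "'a::real_vector ^ 'n::finite \<Rightarrow> 'a ^ 'n" where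
  "deviation v = v - vec (mean v)"

lemma mean_add: "mean (u + v) = mean u + mean v"
  by (simp add: mean_def sum.distrib scaleR_add_right)

lemma mean_diff: "mean (u - v) = mean u - mean v"
  by (simp add: mean_def sum_subtractf scaleR_diff_right)

lemma mean_vec [simp]: "mean (vec a :: 'a::real_vector ^ 'n::finite) = a"
  by (simp add: mean_def sum_constant_scaleR del: sum_constant)

lemma mean_component: "mean v $ c = mean (\<chi> i. v $ i $ c)"
  for v :: "(real ^ 'd::finite) ^ 'n::finite"
  by (simp add: mean_def)

lemma mean_real_nonneg: "(\<And>i. 0 \<le> v $ i) \<Longrightarrow> 0 \<le> mean v"
  for v :: "real ^ 'n::finite"
  by (simp add: mean_def sum_nonneg)

lemma norm_mean_le:
  fixes v :: "'a::real_normed_vector ^ 'n::finite"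
  assumes "\<And>i. norm (v $ i) \<le> c"
  shows "norm (mean v) \<le> c"
proof -
  have "norm (\<Sum>i\<in>UNIV. v $ i) \<le> real CARD('n) * c"
    using sum_norm_bound[of UNIV "\<lambda>i. v $ i" c] assms by simp
  then show ?thesis by (simp add: mean_def divide_le_eq mult.commute)
qed

lemma mean_deviation [simp]: "mean (deviation v) = 0"
  by (simp add: deviation_def mean_diff)

lemma deviation_add: "deviation (u + v) = deviation u + deviation v"
  by (simp add: deviation_def mean_add vec_eq_iff)

lemma inner_vec_mean: "inner (vec a) v = real CARD('n) * inner a (mean v)"
  for v :: "'a::real_inner ^ 'n::finite"
  by (simp add: inner_vec_eq_sum mean_def inner_sum_right)

lemma norm_sq_vec_const: "(norm (vec a :: 'a::real_inner ^ 'n::finite))\<^sup>2 = real CARD('n) * (norm a)\<^sup>2"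
  by (simp add: power2_norm_eq_inner inner_vec_mean)

text \<open>Constant stacks and stacks of mean zero are orthogonal, so Pythagoras applies.\<close>

lemma norm_sq_mean_deviation:
  fixes v :: "'a::real_inner ^ 'n::finite"
  shows "(norm v)\<^sup>2 = (norm (vec (mean v) :: 'a ^ 'n))\<^sup>2 + (norm (deviation v))\<^sup>2"
proof -
  have "inner (vec (mean v)) (deviation v) = 0"
    by (simp add: inner_vec_mean)
  moreover have "v = vec (mean v) + deviation v"
    by (simp add: deviation_def)
  ultimately show ?thesis
    by (metis norm_add_Pythagorean orthogonal_def)
qed

lemma norm_deviation_le: "norm (deviation v) \<le> norm v"
  for v :: "'a::real_inner ^ 'n::finite"
  by (rule power2_le_imp_le) (simp_all add: norm_sq_mean_deviation[of v])

lemma norm_vec_mean_le: "norm (vec (mean v) :: 'a ^ 'n) \<le> norm v"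
  for v :: "'a::real_inner ^ 'n::finite"
  by (rule power2_le_imp_le) (simp_all add: norm_sq_mean_deviation[of v])

lemma norm_mean_le_norm: "norm (mean v) \<le> norm v"
  for v :: "'a::real_inner ^ 'n::finite"
  by (rule norm_mean_le) (rule Finite_Cartesian_Product.norm_nth_le)

section \<open>Mixing contracts deviations\<close>

definition mix :: "real ^ 'n ^ 'n \<Rightarrow> 'a::real_vector ^ 'n::finite \<Rightarrow> 'a ^ 'n" where
  "mix W v = (\<chi> i. \<Sum>j\<in>UNIV. W $ i $ j *\<^sub>R v $ j)"

lemma mix_nth: "mix W v $ i = (\<Sum>j\<in>UNIV. W $ i $ j *\<^sub>R v $ j)"
  by (simp add: mix_def)

lemma mix_diff: "mix W (u - v) = mix W u - mix W v"
  by (simp add: mix_def vec_eq_iff scaleR_diff_right sum_subtractf)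

lemma mix_scaleR: "mix W (c *\<^sub>R v) = c *\<^sub>R mix W v"
  by (simp add: mix_def vec_eq_iff scaleR_sum_right mult.commute)

lemma mixing_matrix_nonneg: "mixing_matrix E W \<Longrightarrow> 0 \<le> W $ i $ j"
  by (simp add: mixing_matrix_def)

lemma mixing_matrix_row_sum: "mixing_matrix E W \<Longrightarrow> (\<Sum>j\<in>UNIV. W $ i $ j) = 1"
  by (simp add: mixing_matrix_def)

lemma mixing_matrix_column_sum: "mixing_matrix E W \<Longrightarrow> (\<Sum>i\<in>UNIV. W $ i $ j) = 1"
  by (simp add: mixing_matrix_def)

lemma mix_vec:
  assumes "mixing_matrix E W"
  shows "mix W (vec a) = vec a"
  using mixing_matrix_row_sum[OF assms]
  by (simp add: mix_def vec_eq_iff flip: scaleR_sum_left)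

lemma mean_mix:
  fixes v :: "'a::real_vector ^ 'n::finite"
  assumes "mixing_matrix E W"
  shows "mean (mix W v) = mean v"
proof -
  have "(\<Sum>i\<in>UNIV. mix W v $ i) = (\<Sum>j\<in>UNIV. (\<Sum>i\<in>UNIV. W $ i $ j) *\<^sub>R v $ j)"
    unfolding mix_nth scaleR_sum_left by (rule sum.swap)
  then show ?thesis
    by (simp add: mean_def mixing_matrix_column_sum[OF assms])
qed

lemma deviation_mix: "mixing_matrix E W \<Longrightarrow> deviation (mix W v) = mix W (deviation v)"
  by (simp add: deviation_def mean_mix mix_diff mix_vec)

text \<open>
  The loss in Jensen's inequality for the squared norm, written out: row \<open>i\<close> of \<open>W\<close> is a
  probability vector whose expectation of \<open>v\<close> is \<open>mix W v $ i\<close>, and the variances of these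
  expectations make up the difference.
\<close>

lemma norm_sq_mix:
  fixes v :: "'a::real_inner ^ 'n::finite"
  assumes "mixing_matrix E W"
  shows "(norm (mix W v))\<^sup>2 + (\<Sum>i\<in>UNIV. \<Sum>j\<in>UNIV. W $ i $ j * (norm (v $ j - mix W v $ i))\<^sup>2)
    = (norm v)\<^sup>2"
proof -
  have row: "(\<Sum>j\<in>UNIV. W $ i $ j * (norm (v $ j - mix W v $ i))\<^sup>2)
      = (\<Sum>j\<in>UNIV. W $ i $ j * (norm (v $ j))\<^sup>2) - (norm (mix W v $ i))\<^sup>2" for i
  proof -
    let ?m = "mix W v $ i"
    have "(\<Sum>j\<in>UNIV. W $ i $ j * (norm (v $ j - ?m))\<^sup>2)
      = (\<Sum>j\<in>UNIV. W $ i $ j * (norm (v $ j))\<^sup>2 - 2 * inner (W $ i $ j *\<^sub>R v $ j) ?m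
            + W $ i $ j * (norm ?m)\<^sup>2)"
      by (simp add: power2_norm_eq_inner inner_diff inner_commute algebra_simps)
    also have "\<dots> = (\<Sum>j\<in>UNIV. W $ i $ j * (norm (v $ j))\<^sup>2)
        - 2 * inner (\<Sum>j\<in>UNIV. W $ i $ j *\<^sub>R v $ j) ?m + (\<Sum>j\<in>UNIV. W $ i $ j) * (norm ?m)\<^sup>2"
      by (simp only: sum.distrib sum_subtractf sum_distrib_left sum_distrib_right inner_sum_left)
    also have "(\<Sum>j\<in>UNIV. W $ i $ j *\<^sub>R v $ j) = ?m" by (simp add: mix_nth)
    also have "(\<Sum>j\<in>UNIV. W $ i $ j) = 1" by (rule mixing_matrix_row_sum[OF assms])
    finally show ?thesis by (simp add: power2_norm_eq_inner)
  qed
  have "(\<Sum>i\<in>UNIV. \<Sum>j\<in>UNIV. W $ i $ j * (norm (v $ j))\<^sup>2)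
      = (\<Sum>j\<in>UNIV. (\<Sum>i\<in>UNIV. W $ i $ j) * (norm (v $ j))\<^sup>2)"
    unfolding sum_distrib_right by (rule sum.swap)
  then show ?thesis
    by (simp add: row sum_subtractf norm_sq_vec_eq_sum mixing_matrix_column_sum[OF assms])
qed

lemma norm_mix_le:
  fixes v :: "'a::real_inner ^ 'n::finite"
  assumes "mixing_matrix E W"
  shows "norm (mix W v) \<le> norm v"
proof (rule power2_le_imp_le)
  have "0 \<le> (\<Sum>i\<in>UNIV. \<Sum>j\<in>UNIV. W $ i $ j * (norm (v $ j - mix W v $ i))\<^sup>2)"
    by (intro sum_nonneg mult_nonneg_nonneg mixing_matrix_nonneg[OF assms]) auto
  with norm_sq_mix[OF assms, of v] show "(norm (mix W v))\<^sup>2 \<le> (norm v)\<^sup>2" by linarith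
qed simp

text \<open>
  If no norm is lost, every variance in the Jensen defect vanishes. As \<open>W $ i $ i > 0\<close>, agent
  \<open>i\<close> already holds the local average, so it agrees with its neighbours, and connectedness spreads
  the agreement to all agents.
\<close>

lemma norm_mix_less:
  fixes v :: "'a::real_inner ^ 'n::finite"
  assumes E: "connected_graph E" and W: "mixing_matrix E W"
    and "mean v = 0" and "v \<noteq> 0"
  shows "norm (mix W v) < norm v"
proof (rule ccontr)
  assume "\<not> norm (mix W v) < norm v"
  with norm_mix_le[OF W, of v] have "norm (mix W v) = norm v" by simp
  with norm_sq_mix[OF W, of v]
  have "(\<Sum>i\<in>UNIV. \<Sum>j\<in>UNIV. W $ i $ j * (norm (v $ j - mix W v $ i))\<^sup>2) = 0"
    by simp
  then have zero: "W $ i $ j * (norm (v $ j - mix W v $ i))\<^sup>2 = 0" for i j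
    by (simp add: sum_nonneg_eq_0_iff sum_nonneg mixing_matrix_nonneg[OF W])
  have neighbour: "v $ j = mix W v $ i" if "W $ i $ j \<noteq> 0" for i j
    using zero[of i j] that by simp
  have "W $ i $ i \<noteq> 0" for i
    using W by (auto simp: mixing_matrix_def dest: spec[of _ i])
  then have self: "v $ i = mix W v $ i" for i
    by (rule neighbour)
  have edge: "v $ j = v $ i" if "{i, j} \<in> E" for i j
  proof -
    have "W $ i $ j \<noteq> 0" using W that by (simp add: mixing_matrix_def)
    then show ?thesis using neighbour self by metis
  qed
  have same: "v $ j = v $ i" for i j
  proof -
    have "(i, j) \<in> {(a, b). {a, b} \<in> E}\<^sup>*" using E by (simp add: connected_graph_def)
    then show ?thesis by induction (auto dest: edge)
  qed
  obtain k :: 'n where True by simp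
  have "v = vec (v $ k)" using same[of _ k] by (simp add: vec_eq_iff)
  then have "v $ k = 0" using \<open>mean v = 0\<close> mean_vec by metis
  with \<open>v = vec (v $ k)\<close> have "v = 0" by (simp add: vec_eq_iff)
  with \<open>v \<noteq> 0\<close> show False by simp
qed

text \<open>
  The strict inequality becomes a uniform factor because the unit sphere of the space of stacks of
  mean zero is compact.
\<close>

lemma mix_contracts_deviation:
  fixes E :: "'n::finite set set"
  assumes E: "connected_graph E" and W: "mixing_matrix E W"
  obtains \<beta> where "0 \<le> \<beta>" "\<beta> < 1"
    "\<And>v :: 'a::euclidean_space ^ 'n. mean v = 0 \<Longrightarrow> norm (mix W v) \<le> \<beta> * norm v"
proof -
  let ?Z = "sphere 0 1 \<inter> {v :: 'a ^ 'n. mean v = 0}"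
  have cont_mix: "continuous_on UNIV (\<lambda>v :: 'a ^ 'n. norm (mix W v))"
    unfolding mix_def by (intro continuous_intros)
  have "continuous_on UNIV (mean :: 'a ^ 'n \<Rightarrow> 'a)"
    unfolding mean_def by (intro continuous_intros)
  then have "closed {v :: 'a ^ 'n. mean v = 0}"
    by (intro closed_Collect_eq continuous_intros)
  then have compact: "compact ?Z"
    by (simp add: compact_Int_closed)
  have "\<exists>\<beta>. 0 \<le> \<beta> \<and> \<beta> < 1 \<and> (\<forall>v\<in>?Z. norm (mix W v) \<le> \<beta>)"
  proof (cases "?Z = {}")
    case True
    then show ?thesis by (auto intro: exI[of _ 0])
  next
    case False
    obtain u where u: "u \<in> ?Z" "\<And>v. v \<in> ?Z \<Longrightarrow> norm (mix W v) \<le> norm (mix W u)"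
      using continuous_attains_sup[OF compact False continuous_on_subset[OF cont_mix]] by auto
    then have "u \<noteq> 0" "mean u = 0" "norm u = 1" by auto
    then have "norm (mix W u) < 1" using norm_mix_less[OF E W, of u] by simp
    with u show ?thesis by (intro exI[of _ "norm (mix W u)"]) auto
  qed
  then obtain \<beta> where \<beta>: "0 \<le> \<beta>" "\<beta> < 1" "\<And>v. v \<in> ?Z \<Longrightarrow> norm (mix W v) \<le> \<beta>" by blast
  have "norm (mix W v) \<le> \<beta> * norm v" if "mean v = 0" for v :: "'a ^ 'n"
  proof (cases "v = 0")
    case True
    then show ?thesis by (simp add: mix_def norm_vec_def L2_set_def)
  next
    case False
    have "mean ((1 / norm v) *\<^sub>R v) = (1 / norm v) *\<^sub>R mean v"
      by (simp add: mean_def flip: scaleR_sum_right)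
    with that False have "norm (mix W ((1 / norm v) *\<^sub>R v)) \<le> \<beta>"
      by (intro \<beta>(3)) auto
    with False show ?thesis
      by (simp add: mix_scaleR divide_le_eq)
  qed
  with \<beta>(1,2) show thesis by (rule that)
qed

section \<open>Scalar recursions\<close>

lemma eventually_le_of_contraction:
  fixes a :: "nat \<Rightarrow> real"
  assumes rec: "\<forall>\<^sub>F t in sequentially. a (Suc t) \<le> q * a t + c"
    and "0 \<le> q" "q < 1" and K: "c / (1 - q) < K"
  shows "\<forall>\<^sub>F t in sequentially. a t \<le> K"
proof -
  let ?l = "c / (1 - q)"
  have fix_l: "q * ?l + c = ?l" using \<open>q < 1\<close> by (simp add: field_simps)
  obtain N where N: "\<And>t. N \<le> t \<Longrightarrow> a (Suc t) \<le> q * a t + c"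
    using rec by (auto simp: eventually_sequentially)
  have geometric: "a (k + N) \<le> q ^ k * (a N - ?l) + ?l" for k
  proof (induction k)
    case 0
    then show ?case by simp
  next
    case (Suc k)
    have "a (Suc k + N) \<le> q * a (k + N) + c" using N[of "k + N"] by simp
    also have "\<dots> \<le> q * (q ^ k * (a N - ?l) + ?l) + c"
      using mult_left_mono[OF Suc.IH \<open>0 \<le> q\<close>] by simp
    also have "\<dots> = q ^ Suc k * (a N - ?l) + (q * ?l + c)" by (simp add: algebra_simps)
    finally show ?case by (simp only: fix_l)
  qed
  have "(\<lambda>k. q ^ k * (a N - ?l) + ?l) \<longlonglongrightarrow> 0 * (a N - ?l) + ?l"
    using assms by (intro tendsto_intros LIMSEQ_power_zero) auto
  then have "\<forall>\<^sub>F k in sequentially. q ^ k * (a N - ?l) + ?l < K"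
    using K by (auto dest: order_tendstoD(2))
  then have "\<forall>\<^sub>F k in sequentially. a (k + N) \<le> K"
    by eventually_elim (meson geometric less_imp_le order_trans)
  then show ?thesis by (subst (asm) eventually_sequentially_seg)
qed

text \<open>
  A constant decrease above the threshold \<open>A\<close> forces the sequence below \<open>A\<close> at some time, and one
  step from below \<open>A\<close> overshoots at most to \<open>B\<close>, from where it decreases again.
\<close>

lemma eventually_le_of_decrease:
  fixes a :: "nat \<Rightarrow> real"
  assumes down: "\<forall>\<^sub>F t in sequentially. A < a t \<longrightarrow> a (Suc t) \<le> a t - \<delta>"
    and up: "\<forall>\<^sub>F t in sequentially. a t \<le> A \<longrightarrow> a (Suc t) \<le> B"
    and "0 < \<delta>" "A \<le> B"
  shows "\<forall>\<^sub>F t in sequentially. a t \<le> B"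
proof -
  obtain N where down: "\<And>t. N \<le> t \<Longrightarrow> A < a t \<Longrightarrow> a (Suc t) \<le> a t - \<delta>"
    and up: "\<And>t. N \<le> t \<Longrightarrow> a t \<le> A \<Longrightarrow> a (Suc t) \<le> B"
    using eventually_conj[OF down up] by (auto simp: eventually_sequentially)
  have "\<exists>t\<ge>N. a t \<le> A"
  proof (rule ccontr)
    assume "\<not> (\<exists>t\<ge>N. a t \<le> A)"
    then have above: "A < a t" if "N \<le> t" for t using that by force
    have "a (N + k) \<le> a N - real k * \<delta>" for k
    proof (induction k)
      case (Suc k)
      then show ?case using down[of "N + k"] above[of "N + k"] by (simp add: algebra_simps)
    qed simp
    moreover obtain k :: nat where "a N - A < real k * \<delta>"
      using reals_Archimedean3[OF \<open>0 < \<delta>\<close>] by blast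
    ultimately show False using above[of "N + k"] by (smt (verit) le_add1)
  qed
  then obtain M where M: "N \<le> M" "a M \<le> A" by blast
  have "a t \<le> B" if "M \<le> t" for t
    using that
  proof (induction t rule: dec_induct)
    case base
    then show ?case using M \<open>A \<le> B\<close> by simp
  next
    case (step t)
    then show ?case
      using down[of t] up[of t] M \<open>0 < \<delta>\<close> by (cases "a t \<le> A") auto
  qed
  then show ?thesis by (auto simp: eventually_sequentially)
qed

section \<open>The half-space\<close>

lemma convex_half_space: "convex (half_space l)"
  unfolding half_space_def by (rule convexI) simp

lemma closed_half_space: "closed (half_space l)"
  unfolding half_space_def by (rule closed_halfspace_component_ge_cart)

lemma half_space_nonempty: "half_space l \<noteq> {}"
proof -
  have "0 \<in> half_space l" by (simp add: half_space_def)
  then show ?thesis by blast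
qed

lemma closest_point_half_space:
  "closest_point (half_space l) y = (\<chi> c. if c = l then max 0 (y $ l) else y $ c)" (is "_ = ?p")
proof (rule sym, rule closest_point_unique[OF convex_half_space closed_half_space])
  show "?p \<in> half_space l" by (simp add: half_space_def)
  show "\<forall>z\<in>half_space l. dist y ?p \<le> dist y z"
    unfolding dist_norm by (auto intro!: norm_le_componentwise_cart simp: half_space_def)
qed

definition tangential :: "'d::finite \<Rightarrow> real ^ 'd \<Rightarrow> real ^ 'd" where
  "tangential l v = (\<chi> c. if c = l then 0 else v $ c)"

lemma tangential_nth: "tangential l v $ c = (if c = l then 0 else v $ c)"
  by (simp add: tangential_def)

lemma tangential_diff: "tangential l (u - v) = tangential l u - tangential l v"
  by (simp add: vec_eq_iff tangential_nth)

lemma norm_tangential_le: "norm (tangential l v) \<le> norm v"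
  by (rule norm_le_componentwise_cart) (simp add: tangential_nth)

lemma norm_minus_tangential: "norm (v - tangential l v) = \<bar>v $ l\<bar>"
proof -
  have "v - tangential l v = (v $ l) *\<^sub>R axis l 1"
    by (simp add: vec_eq_iff tangential_nth axis_def)
  then show ?thesis by simp
qed

lemma inner_tangential_left: "inner (tangential l u) v = inner (tangential l u) (tangential l v)"
  by (auto simp: inner_vec_def tangential_nth intro!: sum.cong)

section \<open>The distance to the optimum is of order at most the square root of the step size\<close>

text \<open>
  The analysis sees the cost functions only through their gradient fields \<open>G i\<close>; convexity enters as
  coercivity of the mean field at \<open>xs\<close>. The number \<open>\<beta>\<close> is the contraction factor of mixing, and
  \<open>\<rho>\<close> bounds the distance of the runs under consideration from the optimum.
\<close>

locale projected_gradient_problem =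
  fixes G :: "'n::finite \<Rightarrow> real ^ 'd::finite \<Rightarrow> real ^ 'd"
    and l :: 'd and E :: "'n set set" and W :: "real ^ 'n ^ 'n" and xs :: "real ^ 'd"
    and \<beta> L \<mu> \<omega> \<rho> :: real
  assumes mixing: "mixing_matrix E W"
    and \<beta>_nonneg: "0 \<le> \<beta>" and \<beta>_less: "\<beta> < 1"
    and contraction: "\<And>v :: (real ^ 'd) ^ 'n. mean v = 0 \<Longrightarrow> norm (mix W v) \<le> \<beta> * norm v"
    and L_pos: "0 < L" and \<mu>_pos: "0 < \<mu>" and \<omega>_pos: "0 < \<omega>" and \<rho>_nonneg: "0 \<le> \<rho>"
    and lipschitz: "\<And>i y z. \<lbrakk>y \<in> half_space l; z \<in> half_space l\<rbrakk>
      \<Longrightarrow> norm (G i y - G i z) \<le> L * norm (y - z)"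
    and coercive: "\<And>y. y \<in> half_space l
      \<Longrightarrow> \<mu> / 2 * (norm (y - xs))\<^sup>2 \<le> inner (y - xs) (mean (\<chi> i. G i y))"
    and xs_boundary: "xs $ l = 0"
    and normal_gradient: "\<omega> \<le> mean (\<chi> i. G i xs) $ l"
begin

definition grad :: "(real ^ 'd) ^ 'n \<Rightarrow> (real ^ 'd) ^ 'n" where
  "grad y = (\<chi> i. G i (y $ i))"

text \<open>Bounds for the gradients, for the deviation in units of \<open>\<alpha>\<close>, and for the error of one
  step of the squared distance in units of \<open>\<alpha>\<^sup>2\<close>.\<close>

definition grad_bound :: real where
  "grad_bound = norm (grad (vec xs)) + L * \<rho>"

definition dev_bound :: real where
  "dev_bound = (grad_bound + 1) / (1 - \<beta>)"

definition energy_error :: real where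
  "energy_error = 2 * grad_bound * dev_bound + 2 * L * dev_bound * \<rho> + grad_bound\<^sup>2 + \<mu> * dev_bound\<^sup>2"

lemma grad_nth: "grad y $ i = G i (y $ i)"
  by (simp add: grad_def)

lemma xs_in: "xs \<in> half_space l"
  by (simp add: half_space_def xs_boundary)

lemma grad_bound_nonneg: "0 \<le> grad_bound"
  using L_pos \<rho>_nonneg by (simp add: grad_bound_def)

lemma dev_bound_pos: "0 < dev_bound"
  using grad_bound_nonneg \<beta>_less by (simp add: dev_bound_def)

lemma energy_error_nonneg: "0 \<le> energy_error"
  using grad_bound_nonneg dev_bound_pos L_pos \<rho>_nonneg \<mu>_pos
  by (simp add: energy_error_def)

lemma grad_lipschitz:
  assumes "\<And>i. y $ i \<in> half_space l" "\<And>i. z $ i \<in> half_space l"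
  shows "norm (grad y - grad z) \<le> L * norm (y - z)"
  by (rule norm_le_scaled_componentwise) (use assms lipschitz L_pos in \<open>auto simp: grad_nth\<close>)

lemma norm_mean_grad_diff_le:
  assumes "\<And>i. y $ i \<in> half_space l" "z \<in> half_space l"
    and "\<And>i. norm (y $ i - z) \<le> c"
  shows "norm (mean (grad y) - mean (\<chi> i. G i z)) \<le> L * c"
proof -
  have "norm (G i (y $ i) - G i z) \<le> L * c" for i
    using lipschitz[OF assms(1,2), of i i] mult_left_mono[OF assms(3)[of i], of L] L_pos by linarith
  then show ?thesis
    unfolding mean_diff[symmetric] by (intro norm_mean_le) (simp add: grad_nth)
qed

text \<open>
  Otherwise consider the point \<open>y\<close> reached from \<open>xs\<close> by a gradient step along the boundary. With
  step size \<open>1 / (2 * L)\<close> the mean gradient changes by at most half the norm of its tangential part,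
  so it still has a positive inner product with the direction \<open>xs - y\<close>, against coercivity at \<open>y\<close>.
\<close>

lemma tangential_gradient_zero: "tangential l (mean (\<chi> i. G i xs)) = 0"
proof -
  let ?g = "mean (\<chi> i. G i xs)"
  let ?p = "tangential l ?g"
  define y where "y = xs - (1 / (2 * L)) *\<^sub>R ?p"
  have y: "y \<in> half_space l"
    by (simp add: y_def half_space_def tangential_nth xs_boundary)
  have "0 \<le> inner (y - xs) (mean (\<chi> i. G i y))"
    using coercive[OF y] \<mu>_pos by (smt (verit) divide_nonneg_pos mult_nonneg_nonneg zero_le_power2)
  then have "inner ?p (mean (\<chi> i. G i y)) \<le> 0"
    using L_pos by (simp add: y_def divide_le_0_iff)
  moreover have "norm (mean (grad (vec y)) - ?g) \<le> L * norm (y - xs)"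
    by (rule norm_mean_grad_diff_le) (simp_all add: y xs_in)
  then have "norm (mean (\<chi> i. G i y) - ?g) \<le> norm ?p / 2"
    using L_pos by (simp add: grad_def y_def)
  then have "inner ?p (?g - mean (\<chi> i. G i y)) \<le> norm ?p * (norm ?p / 2)"
    using norm_cauchy_schwarz[of ?p "?g - mean (\<chi> i. G i y)"]
    by (smt (verit) mult_left_mono norm_ge_zero norm_minus_commute)
  moreover have "inner ?p ?g = norm ?p * norm ?p"
    by (simp add: inner_tangential_left[of l ?g ?g] dot_square_norm power2_eq_square)
  ultimately have "norm ?p * norm ?p \<le> 0"
    by (simp add: inner_diff_right)
  then show ?thesis by (simp add: mult_le_0_iff)
qed

end

text \<open>
  The smallness conditions on \<open>\<alpha>\<close> in their order of appearance: they absorb a term of order \<open>\<alpha>\<^sup>3\<close>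
  into \<open>energy_error\<close>, keep the contraction factors nonnegative, make gradient steps along the
  boundary contract, and keep the normal derivative of the mean above \<open>\<omega> / 2\<close>.
\<close>

locale projected_gradient_run = projected_gradient_problem +
  fixes \<alpha> :: real and x :: "nat \<Rightarrow> (real ^ 'b) ^ 'a"
  assumes \<alpha>_pos: "0 < \<alpha>" and \<alpha>_le_1: "\<alpha> \<le> 1" and \<alpha>_\<mu>: "\<alpha> * \<mu> < 1"
    and \<alpha>_L: "\<alpha> * (2 * L\<^sup>2) \<le> \<mu>"
    and \<alpha>_\<omega>: "L\<^sup>2 * ((energy_error / \<mu> + 1) * \<alpha>) \<le> (\<omega> / 2)\<^sup>2"
    and start: "x 0 $ i \<in> half_space l"
    and step: "x (Suc t) $ i =
      closest_point (half_space l) (mix W (x t) $ i - \<alpha> *\<^sub>R G i (x t $ i))"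
    and bounded: "norm (x t - vec xs) \<le> \<rho>"
begin

lemma iterate_in: "x t $ i \<in> half_space l"
  by (cases t) (simp_all add: start step closest_point_in_set closed_half_space half_space_nonempty)

lemma mix_iterate_in: "mix W (x t) $ i \<in> half_space l"
  using iterate_in[of t] mixing_matrix_nonneg[OF mixing]
  by (simp add: half_space_def mix_nth sum_nonneg)

lemma mean_iterate_in: "mean (x t) \<in> half_space l"
  using iterate_in[of t] by (simp add: half_space_def mean_component mean_real_nonneg)

lemma norm_grad_iterate_le: "norm (grad (x t)) \<le> grad_bound"
proof -
  have "norm (grad (x t) - grad (vec xs)) \<le> L * norm (x t - vec xs)"
    by (rule grad_lipschitz) (simp_all add: iterate_in xs_in)
  also have "\<dots> \<le> L * \<rho>" using bounded[of t] L_pos by simp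
  finally show ?thesis
    unfolding grad_bound_def by (smt (verit) norm_triangle_sub)
qed

lemma norm_step_error_le: "norm (x (Suc t) - mix W (x t)) \<le> \<alpha> * grad_bound"
proof -
  have agent: "norm (x (Suc t) $ i - mix W (x t) $ i) \<le> \<alpha> * norm (grad (x t) $ i)" for i
  proof -
    let ?m = "mix W (x t) $ i"
    have "dist (closest_point (half_space l) (?m - \<alpha> *\<^sub>R G i (x t $ i)))
        (closest_point (half_space l) ?m) \<le> dist (?m - \<alpha> *\<^sub>R G i (x t $ i)) ?m"
      by (rule closest_point_lipschitz[OF convex_half_space closed_half_space half_space_nonempty])
    then show ?thesis
      using \<alpha>_pos by (simp add: step grad_nth closest_point_self[OF mix_iterate_in] dist_norm)
  qed
  have "norm (x (Suc t) - mix W (x t)) \<le> \<alpha> * norm (grad (x t))"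
    by (rule norm_le_scaled_componentwise) (use agent \<alpha>_pos in simp_all)
  also have "\<dots> \<le> \<alpha> * grad_bound"
    using norm_grad_iterate_le \<alpha>_pos by simp
  finally show ?thesis .
qed

text \<open>
  Projecting back does not disturb the mixed points, which stay in the half-space; so a step is
  mixing up to an error of order \<open>\<alpha>\<close>, and mixing contracts the deviation.
\<close>

lemma eventually_deviation_le:
  "\<forall>\<^sub>F t in sequentially. norm (deviation (x t)) \<le> dev_bound * \<alpha>"
proof (rule eventually_le_of_contraction[OF always_eventually \<beta>_nonneg \<beta>_less], rule allI)
  fix t
  let ?e = "x (Suc t) - mix W (x t)"
  have "deviation (x (Suc t)) = mix W (deviation (x t)) + deviation ?e"
    by (metis deviation_add deviation_mix[OF mixing] add.commute diff_add_cancel)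
  then have "norm (deviation (x (Suc t))) \<le> norm (mix W (deviation (x t))) + norm ?e"
    using norm_triangle_ineq[of "mix W (deviation (x t))" "deviation ?e"] norm_deviation_le[of ?e]
    by simp
  also have "\<dots> \<le> \<beta> * norm (deviation (x t)) + \<alpha> * grad_bound"
    by (intro add_mono contraction norm_step_error_le) simp
  finally show "norm (deviation (x (Suc t))) \<le> \<beta> * norm (deviation (x t)) + \<alpha> * grad_bound" .
next
  show "\<alpha> * grad_bound / (1 - \<beta>) < dev_bound * \<alpha>"
    using \<alpha>_pos \<beta>_less by (simp add: dev_bound_def divide_less_cancel distrib_left mult.commute)
qed

text \<open>
  Up to errors of order \<open>\<alpha>\<close>, the inner product that governs the squared distance is that of all
  gradients at the common point \<open>mean (x t)\<close>, where coercivity bounds it below.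
\<close>

lemma inner_grad_ge:
  assumes dev: "norm (deviation (x t)) \<le> dev_bound * \<alpha>"
  shows "\<mu> / 2 * (norm (x t - vec xs))\<^sup>2 - \<mu> / 2 * (dev_bound * \<alpha>)\<^sup>2
      - grad_bound * (dev_bound * \<alpha>) - L * (dev_bound * \<alpha>) * \<rho>
    \<le> inner (grad (x t)) (mix W (x t) - vec xs)"
proof -
  let ?m = "vec (mean (x t)) :: (real ^ 'b) ^ 'a"
  let ?D = "dev_bound * \<alpha>"
  have mean_xs: "vec (mean (x t - vec xs)) = ?m - vec xs"
    by (simp add: mean_diff vec_eq_iff)
  have dev_xs: "deviation (x t - vec xs) = deviation (x t)"
    by (simp add: deviation_def mean_xs)
  have at_mean: "\<mu> / 2 * (norm (?m - vec xs))\<^sup>2 \<le> inner (grad ?m) (?m - vec xs)"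
  proof -
    have *: "?m - vec xs = vec (mean (x t) - xs)" by (simp add: vec_eq_iff)
    have "\<mu> / 2 * (norm (?m - vec xs))\<^sup>2
        = real CARD('a) * (\<mu> / 2 * (norm (mean (x t) - xs))\<^sup>2)"
      unfolding * by (simp add: norm_sq_vec_const)
    also have "\<dots> \<le> real CARD('a) * inner (mean (x t) - xs) (mean (\<chi> i. G i (mean (x t))))"
      by (intro mult_left_mono coercive mean_iterate_in) simp
    also have "\<dots> = inner (grad ?m) (?m - vec xs)"
      unfolding * by (subst inner_commute) (simp add: inner_vec_mean grad_def)
    finally show ?thesis .
  qed
  have "(norm (x t - vec xs))\<^sup>2 = (norm (?m - vec xs))\<^sup>2 + (norm (deviation (x t)))\<^sup>2"
    using norm_sq_mean_deviation[of "x t - vec xs"] by (simp add: mean_xs dev_xs)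
  moreover have "(norm (deviation (x t)))\<^sup>2 \<le> ?D\<^sup>2" using dev by (intro power_mono) auto
  ultimately have "\<mu> / 2 * (norm (x t - vec xs))\<^sup>2
      \<le> \<mu> / 2 * ((norm (?m - vec xs))\<^sup>2 + ?D\<^sup>2)"
    using \<mu>_pos by (intro mult_left_mono) auto
  moreover have "\<bar>inner (grad (x t) - grad ?m) (?m - vec xs)\<bar> \<le> (L * ?D) * \<rho>"
  proof -
    have "norm (grad (x t) - grad ?m) \<le> L * norm (x t - ?m)"
      by (rule grad_lipschitz) (simp_all add: iterate_in mean_iterate_in)
    also have "\<dots> \<le> L * ?D" using dev L_pos by (simp add: deviation_def)
    finally have 1: "norm (grad (x t) - grad ?m) \<le> L * ?D" .
    have "norm (?m - vec xs) \<le> \<rho>"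
      using norm_vec_mean_le[of "x t - vec xs"] bounded[of t] by (simp add: mean_xs)
    with 1 have "norm (grad (x t) - grad ?m) * norm (?m - vec xs) \<le> (L * ?D) * \<rho>"
      using L_pos \<alpha>_pos dev_bound_pos by (intro mult_mono) auto
    then show ?thesis
      by (rule order_trans[OF Cauchy_Schwarz_ineq2])
  qed
  moreover have "\<bar>inner (grad (x t)) (mix W (x t) - ?m)\<bar> \<le> grad_bound * ?D"
  proof -
    have "mix W (x t) - ?m = mix W (deviation (x t))"
      by (simp add: deviation_def mix_diff mix_vec[OF mixing])
    then have "norm (mix W (x t) - ?m) \<le> ?D"
      using norm_mix_le[OF mixing, of "deviation (x t)"] dev by simp
    then have "norm (grad (x t)) * norm (mix W (x t) - ?m) \<le> grad_bound * ?D"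
      using norm_grad_iterate_le grad_bound_nonneg by (intro mult_mono) auto
    then show ?thesis
      by (rule order_trans[OF Cauchy_Schwarz_ineq2])
  qed
  moreover have "inner (grad (x t)) (mix W (x t) - vec xs)
      = inner (grad ?m) (?m - vec xs) + inner (grad (x t) - grad ?m) (?m - vec xs)
        + inner (grad (x t)) (mix W (x t) - ?m)"
    by (simp add: inner_diff algebra_simps)
  ultimately show ?thesis
    using at_mean by (simp add: algebra_simps)
qed

lemma norm_sq_step_le:
  "(norm (x (Suc t) - vec xs))\<^sup>2
    \<le> (norm (x t - vec xs))\<^sup>2 - 2 * \<alpha> * inner (grad (x t)) (mix W (x t) - vec xs)
      + \<alpha>\<^sup>2 * grad_bound\<^sup>2"
proof -
  let ?y = "mix W (x t) - \<alpha> *\<^sub>R grad (x t)"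
  have agent: "norm (x (Suc t) $ i - xs) \<le> norm (?y $ i - xs)" for i
    using closest_point_lipschitz[OF convex_half_space closed_half_space half_space_nonempty,
        of l "?y $ i" xs]
    by (simp add: step grad_nth closest_point_self[OF xs_in] dist_norm)
  have "norm (x (Suc t) - vec xs) \<le> norm (?y - vec xs)"
    by (rule norm_le_componentwise_cart) (use agent in simp)
  then have "(norm (x (Suc t) - vec xs))\<^sup>2 \<le> (norm (?y - vec xs))\<^sup>2"
    by (intro power_mono) auto
  also have "\<dots> = (norm (mix W (x t) - vec xs))\<^sup>2
      - 2 * \<alpha> * inner (grad (x t)) (mix W (x t) - vec xs) + \<alpha>\<^sup>2 * (norm (grad (x t)))\<^sup>2"
    using norm_sq_diff_scaleR[of "mix W (x t) - vec xs" \<alpha> "grad (x t)"]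
    by (simp add: inner_commute algebra_simps)
  also have "\<dots> \<le> (norm (x t - vec xs))\<^sup>2
      - 2 * \<alpha> * inner (grad (x t)) (mix W (x t) - vec xs) + \<alpha>\<^sup>2 * grad_bound\<^sup>2"
  proof -
    have "mix W (x t) - vec xs = mix W (x t - vec xs)"
      by (simp add: mix_diff mix_vec[OF mixing])
    then have "(norm (mix W (x t) - vec xs))\<^sup>2 \<le> (norm (x t - vec xs))\<^sup>2"
      using norm_mix_le[OF mixing, of "x t - vec xs"] by (intro power_mono) auto
    moreover have "\<alpha>\<^sup>2 * (norm (grad (x t)))\<^sup>2 \<le> \<alpha>\<^sup>2 * grad_bound\<^sup>2"
      using norm_grad_iterate_le[of t] by (intro mult_left_mono power_mono) auto
    ultimately show ?thesis by linarith
  qed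
  finally show ?thesis .
qed

lemma eventually_norm_sq_le:
  "\<forall>\<^sub>F t in sequentially. (norm (x t - vec xs))\<^sup>2 \<le> (energy_error / \<mu> + 1) * \<alpha>"
proof (rule eventually_le_of_contraction)
  show "\<forall>\<^sub>F t in sequentially. (norm (x (Suc t) - vec xs))\<^sup>2
      \<le> (1 - \<alpha> * \<mu>) * (norm (x t - vec xs))\<^sup>2 + \<alpha>\<^sup>2 * energy_error"
    using eventually_deviation_le
  proof eventually_elim
    case (elim t)
    let ?V = "(norm (x t - vec xs))\<^sup>2"
    have "2 * \<alpha> * (\<mu> / 2 * ?V - \<mu> / 2 * (dev_bound * \<alpha>)\<^sup>2
        - grad_bound * (dev_bound * \<alpha>) - L * (dev_bound * \<alpha>) * \<rho>)
      \<le> 2 * \<alpha> * inner (grad (x t)) (mix W (x t) - vec xs)"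
      using inner_grad_ge[OF elim] \<alpha>_pos by (intro mult_left_mono) auto
    then have "(norm (x (Suc t) - vec xs))\<^sup>2
        \<le> ?V - 2 * \<alpha> * (\<mu> / 2 * ?V - \<mu> / 2 * (dev_bound * \<alpha>)\<^sup>2
          - grad_bound * (dev_bound * \<alpha>) - L * (dev_bound * \<alpha>) * \<rho>) + \<alpha>\<^sup>2 * grad_bound\<^sup>2"
      using norm_sq_step_le[of t] by linarith
    also have "\<dots> = (1 - \<alpha> * \<mu>) * ?V + \<alpha>\<^sup>2 * (2 * grad_bound * dev_bound
        + 2 * L * dev_bound * \<rho> + grad_bound\<^sup>2 + \<alpha> * (\<mu> * dev_bound\<^sup>2))"
      by (simp add: power2_eq_square algebra_simps)
    also have "\<dots> \<le> (1 - \<alpha> * \<mu>) * ?V + \<alpha>\<^sup>2 * energy_error"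
    proof -
      have "\<alpha> * (\<mu> * dev_bound\<^sup>2) \<le> 1 * (\<mu> * dev_bound\<^sup>2)"
        using \<alpha>_le_1 \<mu>_pos by (intro mult_right_mono) auto
      then show ?thesis
        unfolding energy_error_def by (intro add_left_mono mult_left_mono) auto
    qed
    finally show ?case .
  qed
  show "0 \<le> 1 - \<alpha> * \<mu>" "1 - \<alpha> * \<mu> < 1" using \<alpha>_\<mu> \<alpha>_pos \<mu>_pos by auto
  show "\<alpha>\<^sup>2 * energy_error / (1 - (1 - \<alpha> * \<mu>)) < (energy_error / \<mu> + 1) * \<alpha>"
    using \<alpha>_pos \<mu>_pos by (simp add: field_simps power2_eq_square)
qed

section \<open>The normal component is of order the step size\<close>

lemma eventually_mean_normal_gradient_ge:
  "\<forall>\<^sub>F t in sequentially. \<omega> / 2 \<le> mean (grad (x t)) $ l"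
  using eventually_norm_sq_le
proof eventually_elim
  case (elim t)
  let ?r = "norm (x t - vec xs)"
  have "norm (x t $ i - xs) \<le> ?r" for i
    using Finite_Cartesian_Product.norm_nth_le[of "x t - vec xs" i] by simp
  then have "norm (mean (grad (x t)) - mean (\<chi> i. G i xs)) \<le> L * ?r"
    by (intro norm_mean_grad_diff_le) (simp_all add: iterate_in xs_in)
  moreover have "L * ?r \<le> \<omega> / 2"
  proof (rule power2_le_imp_le)
    have "L\<^sup>2 * ?r\<^sup>2 \<le> L\<^sup>2 * ((energy_error / \<mu> + 1) * \<alpha>)"
      using elim by (intro mult_left_mono) auto
    with \<alpha>_\<omega> show "(L * ?r)\<^sup>2 \<le> (\<omega> / 2)\<^sup>2" by (simp add: power_mult_distrib)
  qed (use \<omega>_pos in simp)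
  ultimately have "\<bar>(mean (grad (x t)) - mean (\<chi> i. G i xs)) $ l\<bar> \<le> \<omega> / 2"
    by (intro norm_bound_component_le_cart) linarith
  with normal_gradient show ?case unfolding vector_minus_component by linarith
qed

text \<open>
  While the mean normal component exceeds a multiple of \<open>\<alpha>\<close>, all agents are so far from the
  boundary that no projection is active. The mean then makes an exact gradient step, which lowers
  its normal component by at least \<open>\<alpha> * \<omega> / 2\<close>.
\<close>

lemma eventually_mean_normal_le:
  "\<forall>\<^sub>F t in sequentially. mean (x t) $ l \<le> (2 * grad_bound + dev_bound) * \<alpha>"
proof (rule eventually_le_of_decrease[where A = "(grad_bound + dev_bound) * \<alpha>" and \<delta> = "\<alpha> * \<omega> / 2"])
  show "\<forall>\<^sub>F t in sequentially. (grad_bound + dev_bound) * \<alpha> < mean (x t) $ l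
      \<longrightarrow> mean (x (Suc t)) $ l \<le> mean (x t) $ l - \<alpha> * \<omega> / 2"
    using eventually_deviation_le eventually_mean_normal_gradient_ge
  proof eventually_elim
    case (elim t)
    show ?case
    proof
      assume far: "(grad_bound + dev_bound) * \<alpha> < mean (x t) $ l"
      have positive: "0 < (mix W (x t) $ i - \<alpha> *\<^sub>R G i (x t $ i)) $ l" for i
      proof -
        have "mix W (deviation (x t)) $ i = mix W (x t) $ i - mean (x t)"
          by (simp add: deviation_def mix_diff mix_vec[OF mixing])
        then have "norm (mix W (x t) $ i - mean (x t)) \<le> dev_bound * \<alpha>"
          using Finite_Cartesian_Product.norm_nth_le[of "mix W (deviation (x t))" i]
            norm_mix_le[OF mixing, of "deviation (x t)"] elim(1)
          by simp
        then have 1: "\<bar>(mix W (x t) $ i - mean (x t)) $ l\<bar> \<le> dev_bound * \<alpha>"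
          by (rule norm_bound_component_le_cart)
        have "norm (G i (x t $ i)) \<le> grad_bound"
          using Finite_Cartesian_Product.norm_nth_le[of "grad (x t)" i] norm_grad_iterate_le[of t]
          by (simp add: grad_nth)
        then have "\<bar>G i (x t $ i) $ l\<bar> \<le> grad_bound"
          by (rule norm_bound_component_le_cart)
        then have "\<alpha> * G i (x t $ i) $ l \<le> \<alpha> * grad_bound"
          using \<alpha>_pos by (intro mult_left_mono) auto
        with 1 far show ?thesis by (simp add: algebra_simps abs_le_iff)
      qed
      have "x (Suc t) = mix W (x t) - \<alpha> *\<^sub>R grad (x t)"
        using positive
        by (auto simp: vec_eq_iff step closest_point_half_space grad_nth max_def less_imp_le)
      then have "mean (x (Suc t)) = mean (x t) - \<alpha> *\<^sub>R mean (grad (x t))"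
        by (simp add: mean_diff mean_mix[OF mixing]) (simp add: mean_def flip: scaleR_sum_right)
      moreover have "\<alpha> * (\<omega> / 2) \<le> \<alpha> * mean (grad (x t)) $ l"
        using elim(2) \<alpha>_pos by (intro mult_left_mono) auto
      ultimately show "mean (x (Suc t)) $ l \<le> mean (x t) $ l - \<alpha> * \<omega> / 2"
        by simp
    qed
  qed
  have "mean (x (Suc t)) $ l \<le> mean (x t) $ l + \<alpha> * grad_bound" for t
  proof -
    have "norm (mean (x (Suc t)) - mean (x t)) \<le> \<alpha> * grad_bound"
      using norm_mean_le_norm[of "x (Suc t) - mix W (x t)"] norm_step_error_le[of t]
      by (simp add: mean_diff mean_mix[OF mixing])
    then have "\<bar>(mean (x (Suc t)) - mean (x t)) $ l\<bar> \<le> \<alpha> * grad_bound"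
      by (rule norm_bound_component_le_cart)
    then show ?thesis by simp
  qed
  then show "\<forall>\<^sub>F t in sequentially. mean (x t) $ l \<le> (grad_bound + dev_bound) * \<alpha>
      \<longrightarrow> mean (x (Suc t)) $ l \<le> (2 * grad_bound + dev_bound) * \<alpha>"
    by (intro always_eventually allI impI) (smt (verit) distrib_right mult.commute)
  show "0 < \<alpha> * \<omega> / 2" using \<alpha>_pos \<omega>_pos by simp
  show "(grad_bound + dev_bound) * \<alpha> \<le> (2 * grad_bound + dev_bound) * \<alpha>"
    using \<alpha>_pos grad_bound_nonneg by (intro mult_right_mono) auto
qed

section \<open>The tangential component is of order the step size\<close>

lemma eventually_near_boundary_point:
  "\<forall>\<^sub>F t in sequentially. \<forall>i.
    norm (x t $ i - tangential l (mean (x t))) \<le> 2 * (grad_bound + dev_bound) * \<alpha>"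
  using eventually_deviation_le eventually_mean_normal_le
proof eventually_elim
  case (elim t)
  show ?case
  proof
    fix i
    have "norm (x t $ i - mean (x t)) \<le> dev_bound * \<alpha>"
      using Finite_Cartesian_Product.norm_nth_le[of "deviation (x t)" i] elim(1)
      by (simp add: deviation_def)
    moreover have "norm (mean (x t) - tangential l (mean (x t))) \<le> (2 * grad_bound + dev_bound) * \<alpha>"
      using elim(2) mean_iterate_in[of t] by (simp add: norm_minus_tangential half_space_def)
    ultimately show "norm (x t $ i - tangential l (mean (x t))) \<le> 2 * (grad_bound + dev_bound) * \<alpha>"
      using norm_diff_triangle_le[of "x t $ i" "mean (x t)" "dev_bound * \<alpha>"
          "tangential l (mean (x t))" "(2 * grad_bound + dev_bound) * \<alpha>"]
      by (simp add: algebra_simps)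
  qed
qed

text \<open>
  An exact gradient step inside the boundary hyperplane contracts the distance to \<open>xs\<close>; there the
  normal derivative is orthogonal to the displacement, so only tangential derivatives enter.
\<close>

lemma boundary_step_contracts:
  fixes y :: "real ^ 'b"
  defines "g \<equiv> tangential l (mean (\<chi> i. G i y))"
  assumes "y $ l = 0"
  shows "norm (y - xs - \<alpha> *\<^sub>R g) \<le> (1 - \<alpha> * \<mu> / 4) * norm (y - xs)"
proof (rule power2_le_imp_le)
  let ?u = "y - xs"
  have y: "y \<in> half_space l" using \<open>y $ l = 0\<close> by (simp add: half_space_def)
  have "?u = tangential l ?u"
    using \<open>y $ l = 0\<close> xs_boundary by (simp add: vec_eq_iff tangential_nth)
  then have "inner ?u (mean (\<chi> i. G i y)) = inner ?u g"
    unfolding g_def by (metis inner_tangential_left)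
  then have 1: "\<mu> / 2 * (norm ?u)\<^sup>2 \<le> inner ?u g" using coercive[OF y] by simp
  have "g = tangential l (mean (\<chi> i. G i y) - mean (\<chi> i. G i xs))"
    by (simp add: g_def tangential_diff tangential_gradient_zero)
  moreover have "norm (mean (grad (vec y)) - mean (\<chi> i. G i xs)) \<le> L * norm ?u"
    by (rule norm_mean_grad_diff_le) (simp_all add: y xs_in)
  ultimately have "norm g \<le> L * norm ?u"
    using norm_tangential_le[of l "mean (\<chi> i. G i y) - mean (\<chi> i. G i xs)"]
    by (simp add: grad_def)
  then have "(norm g)\<^sup>2 \<le> (L * norm ?u)\<^sup>2" by (intro power_mono) auto
  then have "\<alpha> * (norm g)\<^sup>2 \<le> \<alpha> * (L\<^sup>2 * (norm ?u)\<^sup>2)"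
    using \<alpha>_pos by (simp add: power_mult_distrib)
  also have "\<dots> \<le> \<mu> / 2 * (norm ?u)\<^sup>2"
    using mult_right_mono[OF \<alpha>_L, of "(norm ?u)\<^sup>2"] by simp
  finally have 2: "\<alpha> * (norm g)\<^sup>2 \<le> \<mu> / 2 * (norm ?u)\<^sup>2" .
  have "(norm (?u - \<alpha> *\<^sub>R g))\<^sup>2 = (norm ?u)\<^sup>2 + \<alpha> * (\<alpha> * (norm g)\<^sup>2 - 2 * inner ?u g)"
    unfolding norm_sq_diff_scaleR by (simp add: power2_eq_square algebra_simps)
  also have "\<dots> \<le> (norm ?u)\<^sup>2 + \<alpha> * (- (\<mu> / 2 * (norm ?u)\<^sup>2))"
    using 1 2 \<alpha>_pos by (intro add_left_mono mult_left_mono) auto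
  also have "\<dots> \<le> ((1 - \<alpha> * \<mu> / 4) * norm ?u)\<^sup>2"
    using \<alpha>_pos \<mu>_pos by (simp add: power2_eq_square algebra_simps)
  finally show "(norm (?u - \<alpha> *\<^sub>R g))\<^sup>2 \<le> ((1 - \<alpha> * \<mu> / 4) * norm ?u)\<^sup>2" .
  show "0 \<le> (1 - \<alpha> * \<mu> / 4) * norm ?u"
    using \<alpha>_\<mu> by (intro mult_nonneg_nonneg) auto
qed

text \<open>The projection acts on the normal coordinate only.\<close>

lemma tangential_mean_step:
  "tangential l (mean (x (Suc t))) = tangential l (mean (x t)) - \<alpha> *\<^sub>R tangential l (mean (grad (x t)))"
proof -
  have "mean (x (Suc t)) $ c = mean (mix W (x t) - \<alpha> *\<^sub>R grad (x t)) $ c" if "c \<noteq> l" for c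
    using that by (simp add: mean_component step closest_point_half_space grad_nth)
  moreover have "mean (mix W (x t) - \<alpha> *\<^sub>R grad (x t)) = mean (x t) - \<alpha> *\<^sub>R mean (grad (x t))"
    by (simp add: mean_diff mean_mix[OF mixing]) (simp add: mean_def flip: scaleR_sum_right)
  ultimately show ?thesis
    by (simp add: vec_eq_iff tangential_nth)
qed

lemma eventually_tangential_le:
  "\<forall>\<^sub>F t in sequentially. norm (tangential l (mean (x t)) - xs)
    \<le> (8 * L * (grad_bound + dev_bound) / \<mu> + 1) * \<alpha>"
proof (rule eventually_le_of_contraction)
  let ?e = "L * (2 * (grad_bound + dev_bound) * \<alpha>)"
  show "\<forall>\<^sub>F t in sequentially. norm (tangential l (mean (x (Suc t))) - xs)
      \<le> (1 - \<alpha> * \<mu> / 4) * norm (tangential l (mean (x t)) - xs) + \<alpha> * ?e"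
    using eventually_near_boundary_point
  proof eventually_elim
    case (elim t)
    let ?p = "tangential l (mean (x t))"
    let ?h = "mean (grad (x t))" and ?g = "mean (\<chi> i. G i ?p)"
    have "norm (?h - ?g) \<le> ?e"
      by (rule norm_mean_grad_diff_le[OF iterate_in])
        (use elim in \<open>simp_all add: half_space_def tangential_nth\<close>)
    then have "norm (tangential l (?h - ?g)) \<le> ?e"
      by (rule order_trans[OF norm_tangential_le])
    then have small: "norm (\<alpha> *\<^sub>R tangential l (?h - ?g)) \<le> \<alpha> * ?e"
      using \<alpha>_pos by simp
    have "tangential l (mean (x (Suc t))) - xs
        = (?p - xs - \<alpha> *\<^sub>R tangential l ?g) - \<alpha> *\<^sub>R tangential l (?h - ?g)"
      unfolding tangential_mean_step by (simp add: vec_eq_iff tangential_nth algebra_simps)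
    then have "norm (tangential l (mean (x (Suc t))) - xs)
        \<le> norm (?p - xs - \<alpha> *\<^sub>R tangential l ?g) + norm (\<alpha> *\<^sub>R tangential l (?h - ?g))"
      using norm_triangle_ineq4 by metis
    also have "\<dots> \<le> (1 - \<alpha> * \<mu> / 4) * norm (?p - xs) + \<alpha> * ?e"
      by (intro add_mono boundary_step_contracts small) (simp add: tangential_nth)
    finally show ?case .
  qed
  show "0 \<le> 1 - \<alpha> * \<mu> / 4" "1 - \<alpha> * \<mu> / 4 < 1" using \<alpha>_\<mu> \<alpha>_pos \<mu>_pos by auto
  show "\<alpha> * ?e / (1 - (1 - \<alpha> * \<mu> / 4)) < (8 * L * (grad_bound + dev_bound) / \<mu> + 1) * \<alpha>"
    using \<alpha>_pos \<mu>_pos by (simp add: field_simps)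
qed

lemma eventually_distance_le:
  "\<forall>\<^sub>F t in sequentially. norm (x t $ k - xs)
    \<le> (2 * (grad_bound + dev_bound) + 8 * L * (grad_bound + dev_bound) / \<mu> + 1) * \<alpha>"
  using eventually_near_boundary_point eventually_tangential_le
proof eventually_elim
  case (elim t)
  have "norm (x t $ k - xs) \<le> 2 * (grad_bound + dev_bound) * \<alpha>
      + (8 * L * (grad_bound + dev_bound) / \<mu> + 1) * \<alpha>"
    using elim by (intro norm_diff_triangle_le) auto
  then show ?case by (simp add: distrib_right)
qed

end

section \<open>From cost functions to gradient fields\<close>

lemma has_derivative_gradient:
  fixes f :: "real ^ 'd::finite \<Rightarrow> real"
  assumes "f differentiable_on half_space l" and y: "y \<in> half_space l"
  shows "(f has_derivative (\<lambda>h. inner (gradient (half_space l) f y) h)) (at y within half_space l)"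
proof -
  from assms obtain D where D: "(f has_derivative D) (at y within half_space l)"
    by (auto simp: differentiable_on_def differentiable_def)
  then have "linear D" using has_derivative_linear by blast
  then have "D = (\<lambda>h. inner (adjoint D 1) h)"
    by (simp add: fun_eq_iff inner_commute[of "adjoint D 1"] adjoint_works)
  with D have "(f has_derivative (\<lambda>h. inner (adjoint D 1) h)) (at y within half_space l)" by simp
  with gradient_half_space_eqI[OF y this] show ?thesis by simp
qed

lemma gradient_average:
  fixes f :: "'n::finite \<Rightarrow> real ^ 'd::finite \<Rightarrow> real"
  assumes "\<And>i. f i differentiable_on half_space l" and y: "y \<in> half_space l"
  shows "gradient (half_space l) (average f) y = mean (\<chi> i. gradient (half_space l) (f i) y)"
proof (rule gradient_half_space_eqI[OF y])
  have "(average f has_derivative (\<lambda>h. 1 / real CARD('n) *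
      (\<Sum>i\<in>UNIV. inner (gradient (half_space l) (f i) y) h))) (at y within half_space l)"
    unfolding average_def
    by (intro has_derivative_mult_right has_derivative_sum has_derivative_gradient assms)
  then show "(average f has_derivative (\<lambda>h. inner (mean (\<chi> i. gradient (half_space l) (f i) y)) h))
      (at y within half_space l)"
    by (simp add: mean_def inner_sum_left)
qed

text \<open>
  Strong convexity with base point \<open>y\<close>, evaluated at the minimizer: the two function values cancel
  because \<open>F xs \<le> F y\<close>.
\<close>

lemma strongly_convex_coercive:
  assumes "strongly_convex_on \<mu> S F" "is_arg_min F (\<lambda>y. y \<in> S) xs" "y \<in> S"
  shows "\<mu> / 2 * (norm (y - xs))\<^sup>2 \<le> inner (y - xs) (gradient S F y)"
proof -
  have "xs \<in> S" and "F xs \<le> F y"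
    using assms(2,3) by (auto simp: is_arg_min_def not_less)
  then have "F y + inner (xs - y) (gradient S F y) + \<mu> / 2 * (norm (xs - y))\<^sup>2 \<le> F y"
    using assms by (fastforce simp: strongly_convex_on_def)
  then show ?thesis
    by (simp add: inner_diff_left norm_minus_commute)
qed

text \<open>
  The analysis of a run needs a small step size. A larger one is bounded below, and there
  the assumed bound on the iterates is itself of order \<open>\<alpha>\<close>.
\<close>

theorem theorem2p11:
  fixes f :: "'n::finite \<Rightarrow> real ^ 'd::finite \<Rightarrow> real"
    and l :: 'd
    and E :: "'n set set"
    and W :: "real ^ 'n ^ 'n"
    and xs :: "real ^ 'd"
    and L \<mu> \<omega> R\<^sub>s :: real
  assumes "connected_graph E"
    and "mixing_matrix E W"
    and "\<And>i. f i differentiable_on half_space l"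
    and "L > 0"
    and "\<And>i. smooth_on L (half_space l) (f i)"
    and "\<mu> > 0"
    and "strongly_convex_on \<mu> (half_space l) (average f)"
    and "is_arg_min (average f) (\<lambda>x. x \<in> half_space l) xs"
    and "xs $ l = 0"
    and "\<omega> > 0"
    and "gradient (half_space l) (average f) xs $ l \<ge> \<omega>"
    and "R\<^sub>s > 0"
  shows "\<exists>C::real. \<forall>\<alpha>. 0 < \<alpha> \<and> \<alpha> \<le> 2 / (L + \<mu>) \<longrightarrow>
    (\<forall>x. dpg_iterates (half_space l) W f (\<lambda>t. \<alpha>) x \<and>
         (\<forall>t. (norm (x t - (\<chi> i. xs)))\<^sup>2 \<le> R\<^sub>s) \<longrightarrow>
         (\<forall>k. limsup (\<lambda>t. ereal (norm (x t $ k - xs))) \<le> ereal (C * \<alpha>)))"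
proof -
  let ?H = "half_space l"
  let ?G = "\<lambda>i. gradient ?H (f i)"
  obtain \<beta> where \<beta>: "0 \<le> \<beta>" "\<beta> < 1"
    "\<And>v :: (real ^ 'd) ^ 'n. mean v = 0 \<Longrightarrow> norm (mix W v) \<le> \<beta> * norm v"
    using mix_contracts_deviation[OF assms(1,2)] by metis
  have xs_in: "xs \<in> ?H" using assms(9) by (simp add: half_space_def)
  interpret projected_gradient_problem ?G l E W xs \<beta> L \<mu> \<omega> "sqrt R\<^sub>s"
  proof
    show "norm (?G i y - ?G i z) \<le> L * norm (y - z)" if "y \<in> ?H" "z \<in> ?H" for i y z
      using assms(5)[of i] that by (simp add: smooth_on_def)
    show "\<mu> / 2 * (norm (y - xs))\<^sup>2 \<le> inner (y - xs) (mean (\<chi> i. ?G i y))" if "y \<in> ?H" for y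
      using strongly_convex_coercive[OF assms(7,8) that]
      by (simp add: gradient_average[where f = f, OF assms(3) that])
    show "\<omega> \<le> mean (\<chi> i. ?G i xs) $ l"
      using assms(11) by (simp add: gradient_average[where f = f, OF assms(3) xs_in])
  qed (use assms \<beta> in auto)
  define b where "b = energy_error / \<mu> + 1"
  define C where "C = 2 * (grad_bound + dev_bound) + 8 * L * (grad_bound + dev_bound) / \<mu> + 1"
  define \<alpha>0 where "\<alpha>0 = Min {1, 1 / (2 * \<mu>), \<mu> / (2 * L\<^sup>2), (\<omega> / 2)\<^sup>2 / (L\<^sup>2 * b)}"
  have b: "0 < b"
    unfolding b_def using energy_error_nonneg assms(6)
    by (intro add_nonneg_pos divide_nonneg_pos) auto
  have \<alpha>0: "0 < \<alpha>0"
    using b assms(4,6,10) by (simp add: \<alpha>0_def)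
  have bound: "\<forall>\<^sub>F t in sequentially. norm (x t $ k - xs) \<le> max C (sqrt R\<^sub>s / \<alpha>0) * \<alpha>"
    if \<alpha>: "0 < \<alpha>" and dpg: "dpg_iterates ?H W f (\<lambda>t. \<alpha>) x"
      and R: "\<And>t. (norm (x t - (\<chi> i. xs)))\<^sup>2 \<le> R\<^sub>s" for \<alpha> x k
  proof -
    have near: "norm (x t - vec xs) \<le> sqrt R\<^sub>s" for t
      using R[of t] by (simp add: vec_def real_le_rsqrt)
    show ?thesis
    proof (cases "\<alpha> \<le> \<alpha>0")
      case True
      then have small: "\<alpha> \<le> 1" "\<alpha> \<le> 1 / (2 * \<mu>)" "\<alpha> \<le> \<mu> / (2 * L\<^sup>2)"
        "\<alpha> \<le> (\<omega> / 2)\<^sup>2 / (L\<^sup>2 * b)"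
        by (simp_all add: \<alpha>0_def)
      interpret projected_gradient_run ?G l E W xs \<beta> L \<mu> \<omega> "sqrt R\<^sub>s" \<alpha> x
      proof
        show "\<alpha> * \<mu> < 1" using small(2) assms(6) by (simp add: field_simps)
        show "\<alpha> * (2 * L\<^sup>2) \<le> \<mu>" using small(3) assms(4) by (simp add: field_simps)
        show "L\<^sup>2 * ((energy_error / \<mu> + 1) * \<alpha>) \<le> (\<omega> / 2)\<^sup>2"
          using small(4) assms(4) b unfolding b_def[symmetric]
          by (subst (asm) pos_le_divide_eq) (simp_all add: mult_ac)
        show "x (Suc t) $ i = closest_point ?H (mix W (x t) $ i - \<alpha> *\<^sub>R ?G i (x t $ i))" for t i
          using dpg by (simp add: dpg_iterates_def mix_nth)
        show "x 0 $ i \<in> ?H" for i using dpg by (simp add: dpg_iterates_def)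
      qed (use \<alpha> small near in auto)
      have "C * \<alpha> \<le> max C (sqrt R\<^sub>s / \<alpha>0) * \<alpha>"
        using \<alpha> by (intro mult_right_mono) auto
      with eventually_distance_le[of k] show ?thesis
        unfolding C_def by (auto elim!: eventually_mono)
    next
      case False
      have "norm (x t $ k - xs) \<le> max C (sqrt R\<^sub>s / \<alpha>0) * \<alpha>" for t
      proof -
        have "norm (x t $ k - xs) \<le> sqrt R\<^sub>s"
          using Finite_Cartesian_Product.norm_nth_le[of "x t - vec xs" k] near[of t] by simp
        also have "\<dots> \<le> sqrt R\<^sub>s / \<alpha>0 * \<alpha>"
          using False \<alpha>0 assms(12) by (simp add: field_simps)
        also have "\<dots> \<le> max C (sqrt R\<^sub>s / \<alpha>0) * \<alpha>"
          using \<alpha> by (intro mult_right_mono) auto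
        finally show ?thesis .
      qed
      then show ?thesis by simp
    qed
  qed
  show ?thesis
    by (intro exI[of _ "max C (sqrt R\<^sub>s / \<alpha>0)"] allI impI Limsup_bounded)
      (use bound in auto)
qed

end
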